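(* The set $R^+_{ure}$ of all $e$ such that $\mathrm{RTD}^+(\mathcal L_e)$ is finite and witnessed by a uniformly r.e. positive teaching sequence for $\mathcal L_e$ is $\Sigma^0_5$ (i.e. definable by a $\Sigma^0_5$ formula).
   Context: $W_0,W_1,\ldots$ is an acceptable numbering of all r.e. subsets of $\mathbb N$; $L^e_j = \{x : \langle j,x\rangle \in W_e\}$ and $\mathcal L_e = \{L^e_j : j\in\mathbb N\}$. A positive teaching sequence for a family $\mathcal L$ is a sequence $((\mathcal F_0,d_0),(\mathcal F_1,d_1),\ldots)$ (indexed by an initial segment of $\mathbb N$) such that (i) the $\mathcal F_i$ are nonempty and form a partition of $\mathcal L$, and (ii) for every $i$ and every $L\in\mathcal F_i$ there is $S_L\subseteq L$ with $|S_L| = d_i<\infty$ such that for all $L'\in\bigcup_{j\geq i}\mathcal F_j$, $S_L\subseteq L'$ implies $L=L'$. Its order is $\sup_i d_i$, and $\mathrm{RTD}^+(\mathcal L)$ is the infimum of orders of positive teaching sequences for $\mathcal L$. The sequence is uniformly r.e. if there is an r.e. set $W$ with $\mathcal F_i = \{\{x : \langle i,j,x\rangle\in W\} : j\in\mathbb N\}$ for all $i$. "Finite and witnessed by" means there is such a uniformly r.e. positive teaching sequence of finite order. *)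

theory Defs
  imports "HOL-Library.Nat_Bijection" "HOL-Library.Disjoint_Sets" "HOL-Library.Extended_Nat"
begin

text \<open>\<open>recfn k f\<close>: the \<open>k\<close>-ary function \<open>f\<close> is (total) recursive. Arguments are passed as a list;
  only the values on lists of length \<open>k\<close> matter, which is what rule \<open>ext\<close> expresses. Minimisation
  is restricted to regular functions, so that the class consists of total functions.\<close>

inductive recfn :: "nat \<Rightarrow> (nat list \<Rightarrow> nat) \<Rightarrow> bool" where
  zero: "recfn k (\<lambda>xs. 0)"
| succ: "recfn 1 (\<lambda>xs. Suc (xs ! 0))"
| proj: "i < k \<Longrightarrow> recfn k (\<lambda>xs. xs ! i)"
| comp: "recfn (length gs) f \<Longrightarrow> (\<And>g. g \<in> set gs \<Longrightarrow> recfn k g)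
    \<Longrightarrow> recfn k (\<lambda>xs. f (map (\<lambda>g. g xs) gs))"
| prim_rec: "recfn k f \<Longrightarrow> recfn (Suc (Suc k)) g
    \<Longrightarrow> recfn (Suc k) (\<lambda>xs. rec_nat (f (tl xs)) (\<lambda>n r. g (n # r # tl xs)) (hd xs))"
| mu: "recfn (Suc k) f \<Longrightarrow> (\<And>xs. length xs = k \<Longrightarrow> \<exists>y. f (y # xs) = 0)
    \<Longrightarrow> recfn k (\<lambda>xs. LEAST y. f (y # xs) = 0)"
| ext: "recfn k f \<Longrightarrow> (\<And>xs. length xs = k \<Longrightarrow> f xs = g xs) \<Longrightarrow> recfn k g"

definition recursive :: "(nat \<Rightarrow> nat) \<Rightarrow> bool" where
  "recursive f \<longleftrightarrow> recfn 1 (\<lambda>xs. f (xs ! 0))"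

definition recursive_rel :: "nat \<Rightarrow> (nat list \<Rightarrow> bool) \<Rightarrow> bool" where
  "recursive_rel k P \<longleftrightarrow> recfn k (\<lambda>xs. if P xs then 1 else 0)"

definition re :: "nat set \<Rightarrow> bool" where
  "re A \<longleftrightarrow> A = {} \<or> (\<exists>f. recursive f \<and> A = range f)"

definition uniformly_re :: "(nat \<Rightarrow> nat set) \<Rightarrow> bool" where
  "uniformly_re V \<longleftrightarrow> re {prod_encode (e, x) |e x. x \<in> V e}"

definition acceptable_numbering :: "(nat \<Rightarrow> nat set) \<Rightarrow> bool" where
  "acceptable_numbering W \<longleftrightarrow>
     range W = Collect re \<and>
     uniformly_re W \<and>
     (\<forall>V. uniformly_re V \<longrightarrow> (\<exists>f. recursive f \<and> (\<forall>e. V e = W (f e))))"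

text \<open>\<open>Sigma_rel n k P\<close> (\<open>Pi_rel n k P\<close>): on lists of length \<open>k\<close>, \<open>P\<close> is given by a prefix of
  \<open>n\<close> alternating number quantifiers beginning with \<open>\<exists>\<close> (with \<open>\<forall>\<close>), followed by a
  recursive matrix.\<close>

fun Sigma_rel :: "nat \<Rightarrow> nat \<Rightarrow> (nat list \<Rightarrow> bool) \<Rightarrow> bool"
and Pi_rel :: "nat \<Rightarrow> nat \<Rightarrow> (nat list \<Rightarrow> bool) \<Rightarrow> bool" where
  "Sigma_rel 0 k P \<longleftrightarrow> recursive_rel k P"
| "Sigma_rel (Suc n) k P \<longleftrightarrow>
     (\<exists>Q. Pi_rel n (Suc k) Q \<and> (\<forall>xs. length xs = k \<longrightarrow> (P xs \<longleftrightarrow> (\<exists>y. Q (y # xs)))))"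
| "Pi_rel 0 k P \<longleftrightarrow> recursive_rel k P"
| "Pi_rel (Suc n) k P \<longleftrightarrow>
     (\<exists>Q. Sigma_rel n (Suc k) Q \<and> (\<forall>xs. length xs = k \<longrightarrow> (P xs \<longleftrightarrow> (\<forall>y. Q (y # xs)))))"

definition Sigma_set :: "nat \<Rightarrow> nat set \<Rightarrow> bool" where
  "Sigma_set n A \<longleftrightarrow> Sigma_rel n 1 (\<lambda>xs. xs ! 0 \<in> A)"

definition initial_segment :: "nat set \<Rightarrow> bool" where
  "initial_segment I \<longleftrightarrow> (\<forall>i\<in>I. \<forall>j<i. j \<in> I)"

text \<open>A sequence \<open>((F 0, d 0), (F 1, d 1), \<dots>)\<close> is represented by its index set \<open>I\<close> together
  with \<open>F\<close> and \<open>d\<close>, whose values outside \<open>I\<close> are irrelevant.\<close>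

definition pos_teaching_seq ::
  "nat set set \<Rightarrow> nat set \<Rightarrow> (nat \<Rightarrow> nat set set) \<Rightarrow> (nat \<Rightarrow> nat) \<Rightarrow> bool" where
  "pos_teaching_seq \<L> I F d \<longleftrightarrow>
     initial_segment I \<and>
     (\<forall>i\<in>I. F i \<noteq> {}) \<and> disjoint_family_on F I \<and> (\<Union>i\<in>I. F i) = \<L> \<and>
     (\<forall>i\<in>I. \<forall>L\<in>F i. \<exists>S\<subseteq>L. finite S \<and> card S = d i \<and>
        (\<forall>L'\<in>(\<Union>j\<in>{j\<in>I. i \<le> j}. F j). S \<subseteq> L' \<longrightarrow> L = L'))"

definition seq_order :: "nat set \<Rightarrow> (nat \<Rightarrow> nat) \<Rightarrow> enat" where
  "seq_order I d = (SUP i\<in>I. enat (d i))"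

definition RTD_pos :: "nat set set \<Rightarrow> enat" where
  "RTD_pos \<L> = Inf {seq_order I d |I F d. pos_teaching_seq \<L> I F d}"

definition uniformly_re_seq :: "nat set \<Rightarrow> (nat \<Rightarrow> nat set set) \<Rightarrow> bool" where
  "uniformly_re_seq I F \<longleftrightarrow>
     (\<exists>W. re W \<and>
        (\<forall>i\<in>I. F i = {{x. prod_encode (i, prod_encode (j, x)) \<in> W} |j. True}))"

definition lang :: "(nat \<Rightarrow> nat set) \<Rightarrow> nat \<Rightarrow> nat \<Rightarrow> nat set" where
  "lang W e j = {x. prod_encode (j, x) \<in> W e}"

definition lang_family :: "(nat \<Rightarrow> nat set) \<Rightarrow> nat \<Rightarrow> nat set set" where
  "lang_family W e = {lang W e j |j. True}"

definition R_pos_ure :: "(nat \<Rightarrow> nat set) \<Rightarrow> nat set" where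
  "R_pos_ure W = {e. \<exists>I F d. pos_teaching_seq (lang_family W e) I F d \<and>
     uniformly_re_seq I F \<and> seq_order I d < \<infinity>}"

text \<open>Finiteness of the dimension is implied by the witness, hence not a separate conjunct.\<close>

lemma R_pos_ure_RTD_finite:
  assumes "e \<in> R_pos_ure W"
  shows "RTD_pos (lang_family W e) < \<infinity>"
proof -
  obtain I F d where "pos_teaching_seq (lang_family W e) I F d" and fin: "seq_order I d < \<infinity>"
    using assms unfolding R_pos_ure_def by blast
  then have "RTD_pos (lang_family W e) \<le> seq_order I d"
    unfolding RTD_pos_def by (intro Inf_lower) blast
  then show ?thesis using fin by (rule le_less_trans)
qed

end

(* The paper's definition, prefixed by an index w of the sequence, a bound D on its order and a code
   m of its index set, would be a Pi_4 condition were it not for the choice of d_i. The latter is a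
   bounded existential quantifier in front of a forall-exists block; it is moved inside by letting
   the universal quantifier range over codes of (D+1)-tuples, one component for each candidate
   value of d_i. Likewise, "S is contained in an r.e. set" is Sigma_1 by quantifying over a tuple of
   enumeration stages, so no bounded quantifier ever has to be absorbed into the matrix. *)
theory Submission imports Defs begin

section \<open>Recursive functions\<close>

lemma recfn_comp1:
  assumes "recfn 1 (\<lambda>xs. f (xs ! 0))" "recfn k a"
  shows "recfn k (\<lambda>xs. f (a xs))"
  using recfn.comp[of "[a]" "\<lambda>xs. f (xs ! 0)" k] assms by simp

lemma recfn_hd: "recfn (Suc k) hd"
  by (rule recfn.ext[OF recfn.proj[of 0]]) (auto simp: length_Suc_conv)

text \<open>In what follows variables are de Bruijn indices: \<open>hd (tl (\<dots> xs))\<close>.\<close>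

lemma recfn_tl:
  assumes "recfn k f"
  shows "recfn (Suc k) (\<lambda>xs. f (tl xs))"
proof -
  have "recfn (Suc k) (\<lambda>xs. f (map (\<lambda>g. g xs) (map (\<lambda>i xs. xs ! Suc i) [0..<k])))"
    by (rule recfn.comp) (use assms in \<open>auto intro: recfn.proj\<close>)
  then show ?thesis
  proof (rule recfn.ext)
    fix xs :: "nat list"
    assume "length xs = Suc k"
    then have "map (\<lambda>g. g xs) (map (\<lambda>i xs. xs ! Suc i) [0..<k]) = tl xs"
      by (intro nth_equalityI) (auto simp: nth_tl)
    then show "f (map (\<lambda>g. g xs) (map (\<lambda>i xs. xs ! Suc i) [0..<k])) = f (tl xs)" by simp
  qed
qed

lemma recfn_Suc: "recfn k a \<Longrightarrow> recfn k (\<lambda>xs. Suc (a xs))"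
  by (rule recfn_comp1[OF recfn.succ])

text \<open>\<open>prim_rec\<close> recurses on the first entry with the tail as parameters.
  Composing it with \<open>b\<close> followed by all projections lets base, step and counter be
  terms in the same variables.\<close>

lemma recfn_rec_nat:
  assumes a: "recfn k a" and g: "recfn (Suc (Suc k)) (\<lambda>ys. g (hd ys) (hd (tl ys)) (tl (tl ys)))"
    and b: "recfn k b"
  shows "recfn k (\<lambda>xs. rec_nat (a xs) (\<lambda>n r. g n r xs) (b xs))"
proof -
  let ?p = "map (\<lambda>i xs. xs ! i) [0..<k]"
  have "recfn k (\<lambda>xs. (\<lambda>xs. rec_nat (a (tl xs)) (\<lambda>n r. g n r (tl xs)) (hd xs))
      (map (\<lambda>g. g xs) (b # ?p)))"
    by (rule recfn.comp) (use recfn.prim_rec[OF a g] b in \<open>auto intro: recfn.proj\<close>)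
  then show ?thesis
  proof (rule recfn.ext)
    fix xs :: "nat list"
    assume "length xs = k"
    then have "map (\<lambda>g. g xs) ?p = xs"
      by (intro nth_equalityI) auto
    then show "(\<lambda>xs. rec_nat (a (tl xs)) (\<lambda>n r. g n r (tl xs)) (hd xs)) (map (\<lambda>g. g xs) (b # ?p))
        = rec_nat (a xs) (\<lambda>n r. g n r xs) (b xs)"
      by (simp add: comp_def)
  qed
qed

text \<open>Curried form of \<open>mu\<close>: the variable searched for is the new head. Zeros are
  demanded on lists of every length, which spares users a length condition.\<close>

lemma recfn_Least:
  assumes "recfn (Suc k) (\<lambda>ys. f (hd ys) (tl ys))" "\<And>xs. \<exists>y. f y xs = 0"
  shows "recfn k (\<lambda>xs. LEAST y. f y xs = 0)"
  using recfn.mu[OF assms(1)] assms(2) by simp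

lemma recfn_add:
  assumes "recfn k a" "recfn k b"
  shows "recfn k (\<lambda>xs. a xs + b xs)"
proof -
  have "rec_nat m (\<lambda>_ r. Suc r) n = m + n" for m n :: nat
    by (induction n) auto
  then show ?thesis
    using recfn_rec_nat[OF assms(1) _ assms(2), of "\<lambda>_ r _. Suc r"]
    by (simp add: recfn_Suc recfn_tl recfn_hd)
qed

lemma recfn_pred:
  assumes "recfn k a"
  shows "recfn k (\<lambda>xs. a xs - 1)"
proof -
  \<comment> \<open>The step function discards the previous value and returns the counter, which
    lags one behind.\<close>
  have "rec_nat 0 (\<lambda>n _. n) m = m - 1" for m :: nat
    by (cases m) auto
  then show ?thesis
    using recfn_rec_nat[OF recfn.zero recfn_hd assms] by simp
qed

lemma recfn_diff:
  assumes "recfn k a" "recfn k b"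
  shows "recfn k (\<lambda>xs. a xs - b xs)"
proof -
  have "rec_nat m (\<lambda>_ r. r - 1) n = m - n" for m n :: nat
    by (induction n) auto
  then show ?thesis
    using recfn_rec_nat[OF assms(1) _ assms(2), of "\<lambda>_ r _. r - 1"]
    by (simp add: recfn_pred[unfolded One_nat_def] recfn_tl recfn_hd)
qed

section \<open>The Cantor pairing and its projections\<close>

lemma recfn_triangle:
  assumes "recfn k a"
  shows "recfn k (\<lambda>xs. triangle (a xs))"
proof -
  have "rec_nat 0 (\<lambda>n r. Suc (n + r)) m = triangle m" for m :: nat
    by (induction m) (auto simp: triangle_Suc)
  then show ?thesis
    using recfn_rec_nat[OF recfn.zero _ assms, of "\<lambda>n r _. Suc (n + r)"]
    by (simp add: recfn_Suc recfn_add recfn_tl recfn_hd)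
qed

lemma recfn_prod_encode:
  assumes "recfn k a" "recfn k b"
  shows "recfn k (\<lambda>xs. prod_encode (a xs, b xs))"
  unfolding prod_encode_def by (simp add: assms recfn_add recfn_triangle)

definition pfst :: "nat \<Rightarrow> nat" where
  "pfst p = fst (prod_decode p)"

definition psnd :: "nat \<Rightarrow> nat" where
  "psnd p = snd (prod_decode p)"

lemma pfst_encode [simp]: "pfst (prod_encode (a, b)) = a"
  and psnd_encode [simp]: "psnd (prod_encode (a, b)) = b"
  by (simp_all add: pfst_def psnd_def)

lemma triangle_mono: "m \<le> n \<Longrightarrow> triangle m \<le> triangle n"
  by (induction n rule: dec_induct) auto

text \<open>\<open>pdiag (prod_encode (a, b))\<close> is the index \<open>a + b\<close> of the diagonal of \<open>(a, b)\<close>.\<close>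

definition pdiag :: "nat \<Rightarrow> nat" where
  "pdiag p = (LEAST y. Suc p - triangle (Suc y) = 0)"

text \<open>The code of (a, b) is \<open>triangle (a + b) + a\<close>, so it is at least
  \<open>triangle (a + b)\<close> and below \<open>triangle (Suc (a + b))\<close>. The minimised
  difference vanishes exactly when the code is below \<open>triangle (Suc y)\<close>.\<close>

lemma pdiag_encode: "pdiag (prod_encode (a, b)) = a + b"
  unfolding pdiag_def
proof (rule Least_equality)
  fix y
  assume *: "Suc (prod_encode (a, b)) - triangle (Suc y) = 0"
  show "a + b \<le> y"
  proof (rule ccontr)
    assume "\<not> a + b \<le> y"
    then have "triangle (Suc y) \<le> triangle (a + b)" by (intro triangle_mono) auto
    with * show False by (simp add: prod_encode_def)
  qed
qed (simp add: prod_encode_def)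

text \<open>Once the diagonal is known, both coordinates come out by subtraction.\<close>

lemma pfst_psnd_eq: "pfst p = p - triangle (pdiag p)" "psnd p = pdiag p - pfst p"
proof -
  obtain a b where p: "p = prod_encode (a, b)"
    by (metis prod_decode_inverse surj_pair)
  show "pfst p = p - triangle (pdiag p)" "psnd p = pdiag p - pfst p"
    unfolding p pdiag_encode pfst_encode psnd_encode by (simp_all add: prod_encode_def)
qed

lemma recfn_pdiag:
  assumes "recfn k a"
  shows "recfn k (\<lambda>xs. pdiag (a xs))"
  unfolding pdiag_def
proof (rule recfn_Least)
  show "\<exists>y. Suc (a xs) - triangle (Suc y) = 0" for xs
    \<comment> \<open>The search succeeds at \<open>a xs\<close>, since
      \<open>triangle (Suc p)\<close> is at least \<open>Suc p\<close>.\<close>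
    by (rule exI[of _ "a xs"]) simp
qed (intro recfn_diff recfn_Suc recfn_triangle recfn_hd recfn_tl assms)

lemma recfn_pfst: "recfn k a \<Longrightarrow> recfn k (\<lambda>xs. pfst (a xs))"
  unfolding pfst_psnd_eq by (intro recfn_diff recfn_triangle recfn_pdiag)

lemma recfn_psnd: "recfn k a \<Longrightarrow> recfn k (\<lambda>xs. psnd (a xs))"
  unfolding pfst_psnd_eq(2) by (intro recfn_diff recfn_pfst recfn_pdiag)

section \<open>Codes of finite tuples\<close>

text \<open>Tuples are nested pairs: drop \<open>a\<close> heads, then take the head. No length is
  stored, so every number has a component at every index.\<close>

definition pnth :: "nat \<Rightarrow> nat \<Rightarrow> nat" where
  "pnth t a = pfst (rec_nat t (\<lambda>_. psnd) a)"

lemma recfn_pnth: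
  assumes "recfn k a" "recfn k b"
  shows "recfn k (\<lambda>xs. pnth (a xs) (b xs))"
  unfolding pnth_def
  by (intro recfn_pfst recfn_rec_nat[where g = "\<lambda>_ r _. psnd r"] assms recfn_psnd recfn_tl recfn_hd)

text \<open>The induction prepends a component, so the tail must code the shifted function; hence
  \<open>g\<close> is generalised.\<close>

lemma ex_pnth: "\<exists>t. \<forall>a<n. pnth t a = g a"
proof (induction n arbitrary: g)
  case (Suc n)
  obtain t where t: "\<forall>a<n. pnth t a = g (Suc a)" using Suc[of "\<lambda>a. g (Suc a)"] by blast
  let ?t = "prod_encode (g 0, t)"
  have "rec_nat ?t (\<lambda>_. psnd) (Suc a) = rec_nat t (\<lambda>_. psnd) a" for a
    by (induction a) auto
  then have "pnth ?t (Suc a) = pnth t a" for a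
    by (simp only: pnth_def)
  moreover have "pnth ?t 0 = g 0" by (simp add: pnth_def)
  ultimately have "\<forall>a<Suc n. pnth ?t a = g a"
    using t by (metis less_Suc_eq_0_disj)
  then show ?case by blast
qed simp

section \<open>The arithmetical hierarchy\<close>

lemma recursive_rel_Not:
  assumes "recursive_rel k P"
  shows "recursive_rel k (\<lambda>xs. \<not> P xs)"
proof -
  have "recfn k (\<lambda>xs. Suc 0 - (if P xs then 1 else 0))"
    using assms unfolding recursive_rel_def by (intro recfn_diff recfn_Suc recfn.zero)
  then show ?thesis
    unfolding recursive_rel_def by (rule recfn.ext) auto
qed

lemma recursive_rel_disj:
  assumes "recursive_rel k P" "recursive_rel k Q"
  shows "recursive_rel k (\<lambda>xs. P xs \<or> Q xs)"
proof -
  \<comment> \<open>Subtracting twice from 1, with truncation, caps the sum of the characteristic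
    functions at 1.\<close>
  have "recfn k (\<lambda>xs. Suc 0 - (Suc 0 - ((if P xs then 1 else 0) + (if Q xs then 1 else 0))))"
    using assms unfolding recursive_rel_def by (intro recfn_diff recfn_add recfn_Suc recfn.zero)
  then show ?thesis
    unfolding recursive_rel_def by (rule recfn.ext) auto
qed

lemma recursive_rel_conj:
  assumes "recursive_rel k P" "recursive_rel k Q"
  shows "recursive_rel k (\<lambda>xs. P xs \<and> Q xs)"
  using recursive_rel_Not[OF recursive_rel_disj[OF assms[THEN recursive_rel_Not]]] by simp

lemma recursive_rel_le:
  assumes "recfn k a" "recfn k b"
  shows "recursive_rel k (\<lambda>xs. a xs \<le> b xs)"
proof -
  have "recfn k (\<lambda>xs. Suc 0 - (a xs - b xs))"
    using assms by (intro recfn_diff recfn_Suc recfn.zero)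
  then show ?thesis
    unfolding recursive_rel_def by (rule recfn.ext) auto
qed

lemma recursive_rel_less:
  assumes "recfn k a" "recfn k b"
  shows "recursive_rel k (\<lambda>xs. a xs < b xs)"
  using recursive_rel_le[OF recfn_Suc[OF assms(1)] assms(2)] by (simp add: Suc_le_eq)

lemma recursive_rel_eq:
  assumes "recfn k a" "recfn k b"
  shows "recursive_rel k (\<lambda>xs. a xs = b xs)"
  unfolding eq_iff by (intro recursive_rel_conj recursive_rel_le assms)

section \<open>Duality and substitution in the hierarchy\<close>

lemma Sigma_rel_cong:
  assumes "Sigma_rel n k P" "\<And>xs. length xs = k \<Longrightarrow> P xs \<longleftrightarrow> P' xs"
  shows "Sigma_rel n k P'"
proof (cases n)
  case 0
  then have "recfn k (\<lambda>xs. if P xs then 1 else 0)" using assms(1) by (simp add: recursive_rel_def)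
  then have "recfn k (\<lambda>xs. if P' xs then 1 else 0)" by (rule recfn.ext) (simp add: assms(2))
  then show ?thesis using 0 by (simp add: recursive_rel_def)
qed (use assms in auto)

text \<open>One induction proves both, because each quantifier exchanges Sigma and Pi. Through them
  Pi facts are read off from Sigma facts.\<close>

lemma Sigma_rel_Not_iff: "Sigma_rel n k (\<lambda>xs. \<not> P xs) \<longleftrightarrow> Pi_rel n k P"
  and Pi_rel_Not_iff: "Pi_rel n k (\<lambda>xs. \<not> P xs) \<longleftrightarrow> Sigma_rel n k P"
proof (induction n arbitrary: k P)
  case 0
  show "Sigma_rel 0 k (\<lambda>xs. \<not> P xs) \<longleftrightarrow> Pi_rel 0 k P"
    "Pi_rel 0 k (\<lambda>xs. \<not> P xs) \<longleftrightarrow> Sigma_rel 0 k P" for k P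
    using recursive_rel_Not[of k P] recursive_rel_Not[of k "\<lambda>xs. \<not> P xs"] by auto
next
  case (Suc n)
  \<comment> \<open>Letting the matrix range over negations instead makes the induction hypothesis
    applicable.\<close>
  have *: "(\<exists>Q. R Q) \<longleftrightarrow> (\<exists>Q. R (\<lambda>xs. \<not> Q xs))" for R :: "(nat list \<Rightarrow> bool) \<Rightarrow> bool"
  proof
    assume "\<exists>Q. R Q"
    then obtain Q where "R (\<lambda>xs. \<not> (\<not> Q xs))" by auto
    then show "\<exists>Q. R (\<lambda>xs. \<not> Q xs)" by (rule exI[of _ "\<lambda>xs. \<not> Q xs"])
  qed auto
  show "Sigma_rel (Suc n) k (\<lambda>xs. \<not> P xs) \<longleftrightarrow> Pi_rel (Suc n) k P" for k P
    unfolding Sigma_rel.simps Pi_rel.simps by (subst *) (simp add: Suc, metis)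
  show "Pi_rel (Suc n) k (\<lambda>xs. \<not> P xs) \<longleftrightarrow> Sigma_rel (Suc n) k P" for k P
    unfolding Sigma_rel.simps Pi_rel.simps by (subst *) (simp add: Suc, metis)
qed

lemma Pi_rel_cong:
  assumes "Pi_rel n k P" "\<And>xs. length xs = k \<Longrightarrow> P xs \<longleftrightarrow> P' xs"
  shows "Pi_rel n k P'"
  using assms Sigma_rel_cong[of n k "\<lambda>xs. \<not> P xs" "\<lambda>xs. \<not> P' xs"]
  by (simp add: Sigma_rel_Not_iff)

text \<open>Recursive terms pass through the quantifier prefix and are absorbed into the matrix by
  \<open>comp\<close>.\<close>

lemma
  assumes "\<And>g. g \<in> set gs \<Longrightarrow> recfn k g"
  shows Sigma_rel_subst: "Sigma_rel n (length gs) P \<Longrightarrow> Sigma_rel n k (\<lambda>xs. P (map (\<lambda>g. g xs) gs))"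
    and Pi_rel_subst: "Pi_rel n (length gs) P \<Longrightarrow> Pi_rel n k (\<lambda>xs. P (map (\<lambda>g. g xs) gs))"
  using assms
proof (induction n arbitrary: k gs P)
  case 0
  have "recursive_rel k (\<lambda>xs. P (map (\<lambda>g. g xs) gs))"
    if "recursive_rel (length gs) P" "\<And>g. g \<in> set gs \<Longrightarrow> recfn k g" for k gs P
    using recfn.comp[OF that(1)[unfolded recursive_rel_def] that(2)]
    by (simp add: recursive_rel_def)
  then show "Sigma_rel 0 (length gs) P \<Longrightarrow> (\<And>g. g \<in> set gs \<Longrightarrow> recfn k g)
      \<Longrightarrow> Sigma_rel 0 k (\<lambda>xs. P (map (\<lambda>g. g xs) gs))"
    "Pi_rel 0 (length gs) P \<Longrightarrow> (\<And>g. g \<in> set gs \<Longrightarrow> recfn k g)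
      \<Longrightarrow> Pi_rel 0 k (\<lambda>xs. P (map (\<lambda>g. g xs) gs))" for k gs P
    by simp_all
next
  case (Suc n)
  \<comment> \<open>\<open>hs\<close> carries the terms under a quantifier: the bound variable stays
    in front and each old term ignores it.\<close>
  define hs :: "(nat list \<Rightarrow> nat) list \<Rightarrow> (nat list \<Rightarrow> nat) list"
    where "hs gs = hd # map (\<lambda>g xs. g (tl xs)) gs" for gs
  have len: "length (hs gs) = Suc (length gs)" for gs by (simp add: hs_def)
  have map: "map (\<lambda>g. g (y # xs)) (hs gs) = y # map (\<lambda>g. g xs) gs" for y xs gs
    by (simp add: hs_def comp_def)
  have rec: "recfn (Suc k) h" if "h \<in> set (hs gs)" "\<And>g. g \<in> set gs \<Longrightarrow> recfn k g" for h gs k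
    using that by (auto simp: hs_def intro: recfn_hd recfn_tl)
  show "Sigma_rel (Suc n) k (\<lambda>xs. P (map (\<lambda>g. g xs) gs))"
    if "Sigma_rel (Suc n) (length gs) P" and gs: "\<And>g. g \<in> set gs \<Longrightarrow> recfn k g" for k gs P
  proof -
    obtain Q where Q: "Pi_rel n (Suc (length gs)) Q"
      "\<And>xs. length xs = length gs \<Longrightarrow> P xs \<longleftrightarrow> (\<exists>y. Q (y # xs))"
      using \<open>Sigma_rel (Suc n) (length gs) P\<close> by auto
    have "Pi_rel n (Suc k) (\<lambda>xs. Q (map (\<lambda>g. g xs) (hs gs)))"
      using Q(1) gs by (intro Suc.IH(2)) (auto simp: len intro: rec)
    then show ?thesis unfolding Sigma_rel.simps
      by (intro exI conjI, assumption) (simp add: Q(2) map)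
  qed
  show "Pi_rel (Suc n) k (\<lambda>xs. P (map (\<lambda>g. g xs) gs))"
    if "Pi_rel (Suc n) (length gs) P" and gs: "\<And>g. g \<in> set gs \<Longrightarrow> recfn k g" for k gs P
  proof -
    obtain Q where Q: "Sigma_rel n (Suc (length gs)) Q"
      "\<And>xs. length xs = length gs \<Longrightarrow> P xs \<longleftrightarrow> (\<forall>y. Q (y # xs))"
      using \<open>Pi_rel (Suc n) (length gs) P\<close> by auto
    have "Sigma_rel n (Suc k) (\<lambda>xs. Q (map (\<lambda>g. g xs) (hs gs)))"
      using Q(1) gs by (intro Suc.IH(1)) (auto simp: len intro: rec)
    then show ?thesis unfolding Pi_rel.simps
      by (intro exI conjI, assumption) (simp add: Q(2) map)
  qed
qed

text \<open>Serves to re-read the head of a list: as one or both components of a pair or, with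
  \<open>gs\<close> empty, as a dummy variable.\<close>

lemma Pi_rel_subst_prefix:
  assumes "Pi_rel n (length gs + k) P" "\<And>g. g \<in> set gs \<Longrightarrow> recfn (Suc k) g"
  shows "Pi_rel n (Suc k) (\<lambda>zs. P (map (\<lambda>g. g zs) gs @ tl zs))"
proof -
  let ?hs = "gs @ map (\<lambda>i zs. zs ! Suc i) [0..<k]"
  have "Pi_rel n (Suc k) (\<lambda>zs. P (map (\<lambda>g. g zs) ?hs))"
    by (rule Pi_rel_subst) (use assms in \<open>auto intro: recfn.proj\<close>)
  then show ?thesis
  proof (rule Pi_rel_cong)
    fix zs :: "nat list"
    assume "length zs = Suc k"
    then have "map (\<lambda>g. g zs) (map (\<lambda>i zs. zs ! Suc i) [0..<k]) = tl zs"
      by (intro nth_equalityI) (auto simp: nth_tl)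
    then show "P (map (\<lambda>g. g zs) ?hs) \<longleftrightarrow> P (map (\<lambda>g. g zs) gs @ tl zs)" by simp
  qed
qed

section \<open>Closure under connectives and quantifiers\<close>

text \<open>Two leading existential quantifiers merge into one over pairs. The matrices are Pi,
  where a conjunction is the negation of a Sigma disjunction and vice versa; hence both closures are
  proved together.\<close>

lemma Sigma_rel_conj_disj:
  assumes "Sigma_rel n k P" "Sigma_rel n k Q"
  shows "Sigma_rel n k (\<lambda>xs. P xs \<and> Q xs) \<and> Sigma_rel n k (\<lambda>xs. P xs \<or> Q xs)"
  using assms
proof (induction n arbitrary: k P Q)
  case 0
  then show ?case by (simp add: recursive_rel_conj recursive_rel_disj)
next
  case (Suc n)
  have IH: "Pi_rel n k (\<lambda>xs. P xs \<and> Q xs)" "Pi_rel n k (\<lambda>xs. P xs \<or> Q xs)"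
    if "Pi_rel n k P" "Pi_rel n k Q" for k P Q
    using Suc.IH[of k "\<lambda>xs. \<not> P xs" "\<lambda>xs. \<not> Q xs"] that
    by (simp_all add: Sigma_rel_Not_iff del: disj_not1 flip: de_Morgan_conj de_Morgan_disj)
  obtain P' where P': "Pi_rel n (Suc k) P'"
    "\<And>xs. length xs = k \<Longrightarrow> P xs \<longleftrightarrow> (\<exists>y. P' (y # xs))"
    using Suc.prems(1) by auto
  obtain Q' where Q': "Pi_rel n (Suc k) Q'"
    "\<And>xs. length xs = k \<Longrightarrow> Q xs \<longleftrightarrow> (\<exists>y. Q' (y # xs))"
    using Suc.prems(2) by auto
  have P'': "Pi_rel n (Suc k) (\<lambda>zs. P' (pfst (hd zs) # tl zs))"
    using Pi_rel_subst_prefix[of n "[\<lambda>zs. pfst (hd zs)]" k P'] P'(1)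
    by (simp add: recfn_pfst recfn_hd)
  have Q'': "Pi_rel n (Suc k) (\<lambda>zs. Q' (psnd (hd zs) # tl zs))"
    using Pi_rel_subst_prefix[of n "[\<lambda>zs. psnd (hd zs)]" k Q'] Q'(1)
    by (simp add: recfn_psnd recfn_hd)
  have ex: "(\<exists>p. R (pfst p) (psnd p)) \<longleftrightarrow> (\<exists>y z. R y z)" for R
    by (metis pfst_encode psnd_encode)
  show ?case unfolding Sigma_rel.simps
  proof (rule conjI; rule exI, rule conjI)
    show "Pi_rel n (Suc k) (\<lambda>zs. P' (pfst (hd zs) # tl zs) \<and> Q' (psnd (hd zs) # tl zs))"
      "Pi_rel n (Suc k) (\<lambda>zs. P' (pfst (hd zs) # tl zs) \<or> Q' (psnd (hd zs) # tl zs))"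
      by (rule IH[OF P'' Q''])+
  qed (auto simp: P'(2) Q'(2) ex[of "\<lambda>y z. P' (y # _) \<and> Q' (z # _)"]
      ex[of "\<lambda>y z. P' (y # _) \<or> Q' (z # _)"])
qed

lemma Sigma_rel_conj: "Sigma_rel n k P \<Longrightarrow> Sigma_rel n k Q \<Longrightarrow> Sigma_rel n k (\<lambda>xs. P xs \<and> Q xs)"
  and Sigma_rel_disj: "Sigma_rel n k P \<Longrightarrow> Sigma_rel n k Q \<Longrightarrow> Sigma_rel n k (\<lambda>xs. P xs \<or> Q xs)"
  by (simp_all add: Sigma_rel_conj_disj)

lemma Pi_rel_conj: "Pi_rel n k P \<Longrightarrow> Pi_rel n k Q \<Longrightarrow> Pi_rel n k (\<lambda>xs. P xs \<and> Q xs)"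
  and Pi_rel_disj: "Pi_rel n k P \<Longrightarrow> Pi_rel n k Q \<Longrightarrow> Pi_rel n k (\<lambda>xs. P xs \<or> Q xs)"
  using Sigma_rel_conj_disj[of n k "\<lambda>xs. \<not> P xs" "\<lambda>xs. \<not> Q xs"]
  by (simp_all add: Sigma_rel_Not_iff del: disj_not1 flip: de_Morgan_conj de_Morgan_disj)

lemma Sigma_rel_Not: "Pi_rel n k P \<Longrightarrow> Sigma_rel n k (\<lambda>xs. \<not> P xs)"
  and Pi_rel_Not: "Sigma_rel n k P \<Longrightarrow> Pi_rel n k (\<lambda>xs. \<not> P xs)"
  by (simp_all add: Sigma_rel_Not_iff Pi_rel_Not_iff)

lemma Sigma_rel_imp: "Pi_rel n k P \<Longrightarrow> Sigma_rel n k Q \<Longrightarrow> Sigma_rel n k (\<lambda>xs. P xs \<longrightarrow> Q xs)"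
  and Pi_rel_imp: "Sigma_rel n k P \<Longrightarrow> Pi_rel n k Q \<Longrightarrow> Pi_rel n k (\<lambda>xs. P xs \<longrightarrow> Q xs)"
  unfolding imp_conv_disj by (intro Sigma_rel_disj Sigma_rel_Not Pi_rel_disj Pi_rel_Not; simp)+

lemma Sigma_rel_ex:
  assumes "Sigma_rel (Suc n) (Suc k) (\<lambda>ys. P (hd ys) (tl ys))"
  shows "Sigma_rel (Suc n) k (\<lambda>xs. \<exists>y. P y xs)"
proof -
  obtain Q where Q: "Pi_rel n (Suc (Suc k)) Q"
    "\<And>ys. length ys = Suc k \<Longrightarrow> P (hd ys) (tl ys) \<longleftrightarrow> (\<exists>z. Q (z # ys))"
    using assms by auto
  \<comment> \<open>One pair contracts two existential quantifiers: \<open>pfst\<close> is the new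
    variable, \<open>psnd\<close> the witness from the Sigma prefix.\<close>
  have "Pi_rel n (Suc k) (\<lambda>zs. Q (psnd (hd zs) # pfst (hd zs) # tl zs))"
    using Pi_rel_subst_prefix[of n "[\<lambda>zs. psnd (hd zs), \<lambda>zs. pfst (hd zs)]" k Q] Q(1)
      recfn_psnd[OF recfn_hd] recfn_pfst[OF recfn_hd] by fastforce
  moreover have "(\<exists>y. P y xs) \<longleftrightarrow> (\<exists>p. Q (psnd p # pfst p # xs))" if "length xs = k" for xs
  proof -
    have "P y xs \<longleftrightarrow> (\<exists>z. Q (z # y # xs))" for y using Q(2)[of "y # xs"] that by simp
    then show ?thesis by (metis pfst_encode psnd_encode)
  qed
  ultimately show ?thesis unfolding Sigma_rel.simps by (intro exI conjI) auto
qed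

lemma Pi_rel_all:
  assumes "Pi_rel (Suc n) (Suc k) (\<lambda>ys. P (hd ys) (tl ys))"
  shows "Pi_rel (Suc n) k (\<lambda>xs. \<forall>y. P y xs)"
  using Sigma_rel_ex[of n k "\<lambda>y xs. \<not> P y xs"] assms
  by (simp add: Sigma_rel_Not_iff flip: not_all)

text \<open>A dummy universal quantifier is put in front.\<close>

lemma Sigma_rel_Pi_Suc: "Sigma_rel n k P \<Longrightarrow> Pi_rel (Suc n) k P"
proof -
  assume *: "Sigma_rel n k P"
  have "Sigma_rel n (Suc k) (\<lambda>zs. P (tl zs))"
    using * Pi_rel_subst_prefix[of n "[]" k "\<lambda>xs. \<not> P xs"] by (simp add: Pi_rel_Not_iff)
  then show ?thesis unfolding Pi_rel.simps by (intro exI conjI, assumption) simp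
qed

lemma Pi_rel_Sigma_Suc: "Pi_rel n k P \<Longrightarrow> Sigma_rel (Suc n) k P"
  using Sigma_rel_Pi_Suc[of n k "\<lambda>xs. \<not> P xs"] by (simp add: Sigma_rel_Not_iff Pi_rel_Not_iff)

text \<open>At level 0, where Sigma and Pi coincide, a dummy quantifier is prefixed; above it the
  matrix is raised instead.\<close>

lemma Sigma_rel_Suc: "Sigma_rel n k P \<Longrightarrow> Sigma_rel (Suc n) k P"
  and Pi_rel_Suc: "Pi_rel n k P \<Longrightarrow> Pi_rel (Suc n) k P"
proof (induction n arbitrary: k P)
  case 0
  show "Sigma_rel 0 k P \<Longrightarrow> Sigma_rel (Suc 0) k P" for k P
    by (rule Pi_rel_Sigma_Suc) simp
  show "Pi_rel 0 k P \<Longrightarrow> Pi_rel (Suc 0) k P" for k P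
    by (rule Sigma_rel_Pi_Suc) simp
next
  case (Suc n)
  show "Sigma_rel (Suc n) k P \<Longrightarrow> Sigma_rel (Suc (Suc n)) k P" for k P
    unfolding Sigma_rel.simps(2)[of n] Sigma_rel.simps(2)[of "Suc n"] using Suc(2) by blast
  show "Pi_rel (Suc n) k P \<Longrightarrow> Pi_rel (Suc (Suc n)) k P" for k P
    unfolding Pi_rel.simps(2)[of n] Pi_rel.simps(2)[of "Suc n"] using Suc(1) by blast
qed

lemma recursive_rel_Sigma: "recursive_rel k P \<Longrightarrow> Sigma_rel n k P"
  by (induction n) (simp, rule Sigma_rel_Suc)

lemma recursive_rel_Pi: "recursive_rel k P \<Longrightarrow> Pi_rel n k P"
  by (induction n) (simp, rule Pi_rel_Suc)

lemma Pi_rel_ex: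
  assumes "Sigma_rel (Suc n) (Suc k) (\<lambda>ys. P (hd ys) (tl ys))"
  shows "Pi_rel (Suc (Suc n)) k (\<lambda>xs. \<exists>y. P y xs)"
  by (intro Sigma_rel_Pi_Suc Sigma_rel_ex assms)

lemma Sigma_rel_all:
  assumes "Pi_rel (Suc n) (Suc k) (\<lambda>ys. P (hd ys) (tl ys))"
  shows "Sigma_rel (Suc (Suc n)) k (\<lambda>xs. \<forall>y. P y xs)"
  by (intro Pi_rel_Sigma_Suc Pi_rel_all assms)

lemmas recursive_rel_atom = recursive_rel_eq recursive_rel_le recursive_rel_less

text \<open>A calculus that checks the level along the syntax: quantifiers of the leading kind are
  free, those of the other kind cost one level, negations and premises of implications swap Sigma
  and Pi, and recursive atoms fit at any level.\<close>

lemmas arith_rel_intros =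
  Sigma_rel_ex Sigma_rel_all Sigma_rel_conj Sigma_rel_disj Sigma_rel_imp Sigma_rel_Not
  Pi_rel_ex Pi_rel_all Pi_rel_conj Pi_rel_disj Pi_rel_imp Pi_rel_Not
  recursive_rel_atom[THEN recursive_rel_Sigma] recursive_rel_atom[THEN recursive_rel_Pi]
  recfn.zero recfn_hd recfn_tl recfn_Suc recfn_prod_encode recfn_pnth

section \<open>Membership in \<open>W\<close> and the complexity of the teaching condition\<close>

lemma acceptable_numbering_enumeration:
  assumes "acceptable_numbering W"
  shows "\<exists>f. recursive f \<and> (\<forall>e x. x \<in> W e \<longleftrightarrow> (\<exists>s. f s = prod_encode (e, x)))"
proof -
  have ran: "range W = Collect re" and ure: "uniformly_re W"
    using assms by (auto simp: acceptable_numbering_def)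
  have "recfn 1 (\<lambda>xs. xs ! 0)" by (rule recfn.proj) simp
  then have "re (range (\<lambda>x. x))"
    unfolding re_def recursive_def by (intro disjI2 exI[of _ "\<lambda>x. x"] conjI refl)
  \<comment> \<open>An index of the full set makes the coded graph nonempty, which rules out the
    case of \<open>re\<close> without an enumerating function.\<close>
  then obtain u where "W u = UNIV" using ran by (metis imageE mem_Collect_eq surj_id image_ident)
  then have "{prod_encode (e, x) |e x. x \<in> W e} \<noteq> {}" by auto
  with ure obtain f where f: "recursive f"
    and eq: "{prod_encode (e, x) |e x. x \<in> W e} = range f"
    unfolding uniformly_re_def re_def by blast
  have "x \<in> W e \<longleftrightarrow> (\<exists>s. f s = prod_encode (e, x))" for e x
  proof -
    have "x \<in> W e \<longleftrightarrow> prod_encode (e, x) \<in> {prod_encode (e, x) |e x. x \<in> W e}" by auto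
    then show ?thesis unfolding eq by (metis rangeE rangeI)
  qed
  with f show ?thesis by (intro exI conjI allI)
qed

text \<open>The number \<open>m\<close> codes the nonempty initial segment \<open>{..<m}\<close>, or \<open>UNIV\<close> if \<open>m = 0\<close>.\<close>

abbreviation in_seg :: "nat \<Rightarrow> nat \<Rightarrow> bool" where
  "in_seg m i \<equiv> m = 0 \<or> i < m"

text \<open>Here \<open>t\<close> codes a tuple with one component for each possible cardinality \<open>c\<close>, \<open>s\<close> a finite
  set of size \<open>c\<close>, and \<open>u\<close> the stages at which its elements are enumerated by \<open>f\<close>.\<close>

definition teaching_formula :: "(nat \<Rightarrow> nat set) \<Rightarrow> (nat \<Rightarrow> nat) \<Rightarrow> nat \<Rightarrow> bool" where
  "teaching_formula W f e \<longleftrightarrow> (let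
      V = \<lambda>w i j x. prod_encode (i, prod_encode (j, x)) \<in> W w;
      L = \<lambda>e j x. prod_encode (j, x) \<in> W e
    in \<exists>w D m.
    (\<forall>i j i' j'. in_seg m i \<and> in_seg m i' \<and> i \<noteq> i' \<longrightarrow> \<not> (\<forall>x. V w i j x = V w i' j' x)) \<and>
    (\<forall>i j. in_seg m i \<longrightarrow> (\<exists>j'. \<forall>x. V w i j x = L e j' x)) \<and>
    (\<forall>j. \<exists>i j'. in_seg m i \<and> (\<forall>x. L e j x = V w i j' x)) \<and>
    (\<forall>i. in_seg m i \<longrightarrow> (\<forall>t. \<exists>c. c \<le> D \<and> (\<exists>s.
      (\<forall>a b. a < b \<and> b < c \<longrightarrow> pnth s a \<noteq> pnth s b) \<and>
      (\<forall>a. a < c \<longrightarrow> V w i (pnth t c) (pnth s a)) \<and>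
      (\<forall>i' j'. in_seg m i' \<and> i \<le> i' \<longrightarrow>
        (\<exists>u. \<forall>a. a < c \<longrightarrow>
          f (pnth u a) = prod_encode (w, prod_encode (i', prod_encode (j', pnth s a)))) \<longrightarrow>
        (\<forall>x. V w i (pnth t c) x = V w i' j' x))))))"

text \<open>Membership is Sigma_1, so equality of two languages is Pi_2 and the first three
  conjuncts are at most Pi_4. In the last one the clause on \<open>u\<close> is Sigma_2 even with
  \<open>a\<close> treated as unbounded; as a premise it leaves a Pi_2 matrix, so \<open>c\<close>,
  \<open>s\<close> give Sigma_3 and \<open>i\<close>, \<open>t\<close> give Pi_4. Stating the
  premise by membership for each \<open>a\<close> would count as Pi_2 and cost a level. Finally
  \<open>w\<close>, \<open>D\<close>, \<open>m\<close> give Sigma_5.\<close>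

lemma Sigma_rel_teaching_formula:
  assumes f: "recursive f" and mem: "\<And>e x. x \<in> W e \<longleftrightarrow> (\<exists>s. f s = prod_encode (e, x))"
  shows "Sigma_rel 5 1 (\<lambda>xs. teaching_formula W f (hd xs))"
proof -
  note f_rec = recfn_comp1[OF f[unfolded recursive_def]]
  have mem_Sigma: "Sigma_rel (Suc n) k (\<lambda>xs. b xs \<in> W (a xs))"
    if "recfn k a" "recfn k b" for n k a b
    unfolding mem using that by (intro arith_rel_intros f_rec)
  have mem_Pi: "Pi_rel (Suc (Suc n)) k (\<lambda>xs. b xs \<in> W (a xs))"
    if "recfn k a" "recfn k b" for n k a b
    by (intro Sigma_rel_Pi_Suc mem_Sigma that)
  \<comment> \<open>Split into implications, pointwise equality of languages falls under the
    rules.\<close>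
  have iff: "(A = B) \<longleftrightarrow> (A \<longrightarrow> B) \<and> (B \<longrightarrow> A)" for A B by blast
  \<comment> \<open>Level and arity are in successor form so that the rules unify.\<close>
  have "Sigma_rel (Suc (Suc (Suc (Suc (Suc 0))))) (Suc 0) (\<lambda>xs. teaching_formula W f (hd xs))"
    unfolding teaching_formula_def Let_def iff
    by (intro arith_rel_intros f_rec mem_Sigma mem_Pi)
  then show ?thesis
    by (simp only: eval_nat_numeral One_nat_def BitM.simps)
qed

section \<open>Teaching sequences\<close>

lemma initial_segment_cases:
  assumes "initial_segment I"
  shows "I = UNIV \<or> (\<exists>n. I = {..<n})"
proof (cases "I = UNIV")
  case False
  define n where "n = (LEAST n. n \<notin> I)"
  have n: "n \<notin> I" using False unfolding n_def by (metis (mono_tags) LeastI UNIV_eq_I)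
  have "i \<in> I \<longleftrightarrow> i < n" for i
    using n assms not_less_Least[of i "\<lambda>n. n \<notin> I"]
    unfolding n_def[symmetric] initial_segment_def by (metis linorder_neqE_nat)
  then show ?thesis by auto
qed simp

text \<open>If each c \<le> n fails at some \<open>g c\<close>, a single tuple with components
  \<open>g c\<close> refutes all of them at once.\<close>

lemma bounded_ex_all_commute:
  fixes A :: "nat \<Rightarrow> nat \<Rightarrow> bool"
  shows "(\<exists>c\<le>n. \<forall>j. A c j) \<longleftrightarrow> (\<forall>t. \<exists>c\<le>n. A c (pnth t c))"
proof
  assume *: "\<forall>t. \<exists>c\<le>n. A c (pnth t c)"
  show "\<exists>c\<le>n. \<forall>j. A c j"
  proof (rule ccontr)
    assume "\<not> ?thesis"
    then obtain g where g: "\<And>c. c \<le> n \<Longrightarrow> \<not> A c (g c)" by metis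
    obtain t where "\<forall>a<Suc n. pnth t a = g a" using ex_pnth by blast
    then show False using * g by (metis less_Suc_eq_le)
  qed
qed blast

text \<open>The set is listed without repetition by the first \<open>c\<close> components of
  \<open>s\<close>, so distinctness expresses its cardinality.\<close>

lemma ex_finite_set_pnth:
  "(\<exists>S\<subseteq>L. finite S \<and> card S = c \<and> R S) \<longleftrightarrow>
   (\<exists>s. (\<forall>a b. a < b \<and> b < c \<longrightarrow> pnth s a \<noteq> pnth s b) \<and> (\<forall>a. a < c \<longrightarrow> pnth s a \<in> L) \<and>
     R (pnth s ` {..<c}))" (is "?l = ?r")
proof
  assume ?l
  then obtain S where S: "S \<subseteq> L" "finite S" "card S = c" "R S" by blast
  then obtain h where h: "bij_betw h {..<c} S"
    by (metis bij_betw_from_nat_into_finite)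
  obtain s where s: "\<forall>a<c. pnth s a = h a" using ex_pnth by blast
  have img: "pnth s ` {..<c} = S"
    using h s by (auto simp: bij_betw_def)
  have "pnth s a \<noteq> pnth s b" if "a < b \<and> b < c" for a b
    using h s that by (auto simp: bij_betw_def inj_on_def)
  moreover have "pnth s a \<in> L" if "a < c" for a
    using that S(1) img by blast
  ultimately show ?r
    using S(4) unfolding img[symmetric] by (intro exI[of _ s] conjI allI impI)
next
  assume ?r
  then obtain s where s: "\<forall>a b. a < b \<and> b < c \<longrightarrow> pnth s a \<noteq> pnth s b"
    "\<forall>a. a < c \<longrightarrow> pnth s a \<in> L" "R (pnth s ` {..<c})" by blast
  have "inj_on (pnth s) {..<c}" using s(1) by (intro linorder_inj_onI) auto
  then show ?l using s by (intro exI[of _ "pnth s ` {..<c}"]) (auto simp: card_image)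
qed

text \<open>Each element has its own stage; collecting the stages in a tuple moves the existential
  quantifier in front of the bounded universal one.\<close>

lemma image_subset_range_pnth:
  assumes "\<And>x. x \<in> A \<longleftrightarrow> (\<exists>s. f s = g x)"
  shows "pnth s ` {..<c} \<subseteq> A \<longleftrightarrow> (\<exists>u. \<forall>a. a < c \<longrightarrow> f (pnth u a) = g (pnth s a))"
proof
  assume "pnth s ` {..<c} \<subseteq> A"
  then have "\<forall>a<c. \<exists>r. f r = g (pnth s a)" using assms by auto
  then obtain h where h: "\<forall>a<c. f (h a) = g (pnth s a)" by metis
  obtain u where "\<forall>a<c. pnth u a = h a" using ex_pnth by blast
  then show "\<exists>u. \<forall>a. a < c \<longrightarrow> f (pnth u a) = g (pnth s a)" using h by metis
qed (use assms in blast)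

section \<open>From teaching sequences to numerical witnesses\<close>

text \<open>Counterpart of \<open>lang\<close> for a sequence of classes:
  \<open>range (class_lang W w i)\<close> stands for \<open>F i\<close>.\<close>

definition class_lang :: "(nat \<Rightarrow> nat set) \<Rightarrow> nat \<Rightarrow> nat \<Rightarrow> nat \<Rightarrow> nat set" where
  "class_lang W w i j = {x. prod_encode (i, prod_encode (j, x)) \<in> W w}"

text \<open>Numbers replace the witnesses: \<open>w\<close> indexes the r.e. set giving
  \<open>F\<close>, \<open>m\<close> codes \<open>I\<close>, and of \<open>d\<close> only the bound
  \<open>D\<close> remains, with \<open>d i\<close> recovered as the \<open>c\<close> chosen at
  \<open>i\<close>.\<close>

lemma R_pos_ure_iff_teaching:
  assumes "range W = Collect re"
  shows "e \<in> R_pos_ure W \<longleftrightarrow> (\<exists>w D m.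
    (\<forall>i j i' j'. in_seg m i \<and> in_seg m i' \<and> i \<noteq> i' \<longrightarrow> class_lang W w i j \<noteq> class_lang W w i' j') \<and>
    (\<forall>i j. in_seg m i \<longrightarrow> (\<exists>j'. class_lang W w i j = lang W e j')) \<and>
    (\<forall>j. \<exists>i j'. in_seg m i \<and> lang W e j = class_lang W w i j') \<and>
    (\<forall>i. in_seg m i \<longrightarrow> (\<exists>c\<le>D. \<forall>j. \<exists>S\<subseteq>class_lang W w i j. finite S \<and> card S = c \<and>
      (\<forall>i' j'. in_seg m i' \<and> i \<le> i' \<longrightarrow> S \<subseteq> class_lang W w i' j' \<longrightarrow>
         class_lang W w i j = class_lang W w i' j'))))"
  (is "_ \<longleftrightarrow> (\<exists>w D m. ?dis w m \<and> ?sub w m \<and> ?sup w m \<and> ?teach w D m)")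
proof
  assume "e \<in> R_pos_ure W"
  then obtain I F d where pts: "pos_teaching_seq (lang_family W e) I F d"
    and "uniformly_re_seq I F" and fin: "seq_order I d < \<infinity>"
    unfolding R_pos_ure_def by blast
  then obtain V where V: "re V"
    "\<forall>i\<in>I. F i = {{x. prod_encode (i, prod_encode (j, x)) \<in> V} |j. True}"
    unfolding uniformly_re_seq_def by (elim exE conjE)
  obtain w where w: "V = W w" using assms V(1) by blast
  have F: "F i = range (class_lang W w i)" if "i \<in> I" for i
    using bspec[OF V(2) that] by (auto simp: w class_lang_def)
  have U: "(\<Union>i\<in>I. F i) = range (lang W e)"
    using pts by (auto simp: pos_teaching_seq_def lang_family_def)
  \<comment> \<open>A family \<open>lang_family W e\<close> is never empty, so the empty segment
    does not occur and the code 0 is free for \<open>UNIV\<close>.\<close>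
  then have "I \<noteq> {}" by auto
  have "initial_segment I" using pts by (simp add: pos_teaching_seq_def)
  from initial_segment_cases[OF this] obtain m where m: "\<And>i. in_seg m i \<longleftrightarrow> i \<in> I"
  proof
    assume "I = UNIV"
    then show thesis by (intro that[of 0]) simp
  next
    assume "\<exists>n. I = {..<n}"
    then obtain n where "I = {..<n}" ..
    with \<open>I \<noteq> {}\<close> show thesis by (intro that[of n]) auto
  qed
  \<comment> \<open>Finite order means that the supremum is a natural number; it bounds every
    \<open>d i\<close>.\<close>
  obtain D where "seq_order I d = enat D" using fin by auto
  then have D: "d i \<le> D" if "i \<in> I" for i
    using SUP_upper[OF that, of "\<lambda>i. enat (d i)"] by (simp add: seq_order_def)
  have "?dis w m"
  proof (intro allI impI, unfold m)
    fix i j i' j'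
    assume *: "i \<in> I \<and> i' \<in> I \<and> i \<noteq> i'"
    then have "F i \<inter> F i' = {}"
      using pts by (simp add: pos_teaching_seq_def disjoint_family_on_def)
    with * show "class_lang W w i j \<noteq> class_lang W w i' j'" by (auto simp: F)
  qed
  moreover have "?sub w m" "?sup w m"
  proof -
    have U': "(\<Union>i\<in>I. range (class_lang W w i)) = range (lang W e)"
      using U F by simp
    show "?sub w m"
    proof (intro allI impI, unfold m)
      fix i j
      assume "i \<in> I"
      then have "class_lang W w i j \<in> range (lang W e)" unfolding U'[symmetric] by blast
      then show "\<exists>j'. class_lang W w i j = lang W e j'" by blast
    qed
    show "?sup w m"
    proof (unfold m, intro allI)
      fix j
      have "lang W e j \<in> (\<Union>i\<in>I. range (class_lang W w i))" unfolding U' by blast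
      then show "\<exists>i j'. i \<in> I \<and> lang W e j = class_lang W w i j'" by blast
    qed
  qed
  moreover have "?teach w D m"
    unfolding m
  proof (intro allI impI)
    fix i
    assume i: "i \<in> I"
    have *: "\<forall>L\<in>F i. \<exists>S\<subseteq>L. finite S \<and> card S = d i \<and>
        (\<forall>L'\<in>(\<Union>j\<in>{j\<in>I. i \<le> j}. F j). S \<subseteq> L' \<longrightarrow> L = L')"
      using pts i unfolding pos_teaching_seq_def by (elim conjE) (rule bspec)
    have "\<exists>S\<subseteq>class_lang W w i j. finite S \<and> card S = d i \<and>
        (\<forall>i' j'. i' \<in> I \<and> i \<le> i' \<longrightarrow> S \<subseteq> class_lang W w i' j' \<longrightarrow>
          class_lang W w i j = class_lang W w i' j')" for j
    proof -
      have "class_lang W w i j \<in> F i" by (simp add: F[OF i])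
      from bspec[OF * this] obtain S where S: "S \<subseteq> class_lang W w i j" "finite S" "card S = d i"
        "\<forall>L'\<in>(\<Union>j\<in>{j\<in>I. i \<le> j}. F j). S \<subseteq> L' \<longrightarrow> class_lang W w i j = L'"
        by (elim exE conjE)
      have "class_lang W w i j = class_lang W w i' j'"
        if "i' \<in> I \<and> i \<le> i'" "S \<subseteq> class_lang W w i' j'" for i' j'
      proof (rule S(4)[rule_format, OF _ that(2)])
        show "class_lang W w i' j' \<in> (\<Union>j\<in>{j\<in>I. i \<le> j}. F j)"
          using that(1) F by (intro UN_I[of i']) auto
      qed
      with S(1-3) show ?thesis by (intro exI[of _ S] conjI allI impI)
    qed
    then show "\<exists>c\<le>D. \<forall>j. \<exists>S\<subseteq>class_lang W w i j. finite S \<and> card S = c \<and>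
        (\<forall>i' j'. i' \<in> I \<and> i \<le> i' \<longrightarrow> S \<subseteq> class_lang W w i' j' \<longrightarrow>
          class_lang W w i j = class_lang W w i' j')"
      using D[OF i] by (intro exI[of _ "d i"] conjI allI)
  qed
  ultimately show "\<exists>w D m. ?dis w m \<and> ?sub w m \<and> ?sup w m \<and> ?teach w D m"
    by (intro exI conjI)
next
  assume "\<exists>w D m. ?dis w m \<and> ?sub w m \<and> ?sup w m \<and> ?teach w D m"
  then obtain w D m where dis: "?dis w m" and sub: "?sub w m" and sup: "?sup w m"
    and teach: "?teach w D m" by (elim exE conjE)
  define I where "I = {i. in_seg m i}"
  define F where "F i = range (class_lang W w i)" for i
  define T where "T i c j S \<longleftrightarrow> finite S \<and> card S = c \<and>
      (\<forall>i' j'. in_seg m i' \<and> i \<le> i' \<longrightarrow> S \<subseteq> class_lang W w i' j' \<longrightarrow>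
         class_lang W w i j = class_lang W w i' j')" for i c j S
  have "\<forall>i\<in>I. \<exists>c\<le>D. \<forall>j. \<exists>S\<subseteq>class_lang W w i j. T i c j S"
    using teach by (simp only: T_def I_def Ball_def mem_Collect_eq)
  \<comment> \<open>The condition on \<open>d i\<close> involves no other value of \<open>d\<close>,
    so the values can be chosen independently.\<close>
  from bchoice[OF this] obtain d
    where d: "\<forall>i\<in>I. d i \<le> D \<and> (\<forall>j. \<exists>S\<subseteq>class_lang W w i j. T i (d i) j S)" ..
  have "pos_teaching_seq (lang_family W e) I F d"
    unfolding pos_teaching_seq_def
  proof (intro conjI)
    show "initial_segment I" by (auto simp: initial_segment_def I_def)
    show "\<forall>i\<in>I. F i \<noteq> {}" by (simp add: F_def)
    show "disjoint_family_on F I"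
      using dis by (auto simp: disjoint_family_on_def F_def I_def)
    show "(\<Union>i\<in>I. F i) = lang_family W e"
    proof (intro equalityI subsetI)
      fix L
      assume "L \<in> (\<Union>i\<in>I. F i)"
      then obtain i j where "in_seg m i" "L = class_lang W w i j" by (auto simp: F_def I_def)
      with sub[THEN spec, THEN spec, of i j] show "L \<in> lang_family W e"
        by (auto simp: lang_family_def)
    next
      fix L
      assume "L \<in> lang_family W e"
      then obtain j where "L = lang W e j" by (auto simp: lang_family_def)
      with sup[THEN spec, of j] obtain i j' where "in_seg m i" "L = class_lang W w i j'"
        by blast
      then show "L \<in> (\<Union>i\<in>I. F i)" unfolding F_def I_def by blast
    qed
    show "\<forall>i\<in>I. \<forall>L\<in>F i. \<exists>S\<subseteq>L. finite S \<and> card S = d i \<and>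
        (\<forall>L'\<in>(\<Union>j\<in>{j\<in>I. i \<le> j}. F j). S \<subseteq> L' \<longrightarrow> L = L')"
    proof (intro ballI)
      fix i L
      assume i: "i \<in> I" and "L \<in> F i"
      then obtain j where L: "L = class_lang W w i j" by (auto simp: F_def)
      from bspec[OF d i] obtain S where S: "S \<subseteq> L" "T i (d i) j S" unfolding L by blast
      then have "\<forall>L'\<in>(\<Union>j\<in>{j\<in>I. i \<le> j}. F j). S \<subseteq> L' \<longrightarrow> L = L'"
        unfolding T_def L F_def I_def by blast
      moreover have "finite S" "card S = d i"
        using S(2) unfolding T_def by blast+
      ultimately show "\<exists>S\<subseteq>L. finite S \<and> card S = d i \<and>
        (\<forall>L'\<in>(\<Union>j\<in>{j\<in>I. i \<le> j}. F j). S \<subseteq> L' \<longrightarrow> L = L')"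
        using S(1) by (intro exI[of _ S] conjI)
    qed
  qed
  moreover have "uniformly_re_seq I F"
    unfolding uniformly_re_seq_def
    by (rule exI[of _ "W w"]) (use assms in \<open>auto simp: F_def class_lang_def\<close>)
  moreover have "seq_order I d \<le> enat D"
    unfolding seq_order_def using d by (auto intro!: SUP_least)
  then have "seq_order I d < \<infinity>" by (rule le_less_trans) simp
  ultimately show "e \<in> R_pos_ure W" unfolding R_pos_ure_def by blast
qed

text \<open>The three coding lemmas turn the last conjunct into number quantifiers, and
  extensionality turns equality of languages into pointwise equivalence.\<close>

lemma R_pos_ure_iff_teaching_formula:
  assumes ran: "range W = Collect re"
    and mem: "\<And>e x. x \<in> W e \<longleftrightarrow> (\<exists>s. f s = prod_encode (e, x))"
  shows "e \<in> R_pos_ure W \<longleftrightarrow> teaching_formula W f e"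
proof -
  have V_subset: "pnth s ` {..<c} \<subseteq> class_lang W w i j \<longleftrightarrow>
      (\<exists>u. \<forall>a. a < c \<longrightarrow> f (pnth u a) = prod_encode (w, prod_encode (i, prod_encode (j, pnth s a))))"
    for s c w i j
    by (rule image_subset_range_pnth) (simp add: class_lang_def mem)
  show ?thesis
    unfolding R_pos_ure_iff_teaching[OF ran] bounded_ex_all_commute ex_finite_set_pnth V_subset
      teaching_formula_def Let_def
    by (simp only: class_lang_def lang_def set_eq_iff mem_Collect_eq)
qed

theorem theorem14:
  fixes W :: "nat \<Rightarrow> nat set"
  assumes "acceptable_numbering W"
  shows "Sigma_set 5 (R_pos_ure W)"
proof -
  obtain f where f: "recursive f" and "\<forall>e x. x \<in> W e \<longleftrightarrow> (\<exists>s. f s = prod_encode (e, x))"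
    using acceptable_numbering_enumeration[OF assms] by (elim exE conjE)
  then have mem: "x \<in> W e \<longleftrightarrow> (\<exists>s. f s = prod_encode (e, x))" for e x by simp
  have "range W = Collect re"
    using assms by (simp add: acceptable_numbering_def)
  then have iff: "e \<in> R_pos_ure W \<longleftrightarrow> teaching_formula W f e" for e
    by (rule R_pos_ure_iff_teaching_formula[OF _ mem])
  show ?thesis
    unfolding Sigma_set_def
  proof (rule Sigma_rel_cong)
    show "Sigma_rel 5 1 (\<lambda>xs. teaching_formula W f (hd xs))"
      by (rule Sigma_rel_teaching_formula[OF f mem])
    \<comment> \<open>The calculus addresses the argument as \<open>hd xs\<close>,
      \<open>Sigma_set\<close> as \<open>xs ! 0\<close>; they agree on lists of length 1.\<close>
    show "teaching_formula W f (hd xs) \<longleftrightarrow> xs ! 0 \<in> R_pos_ure W" if "length xs = 1" for xs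
      using that by (cases xs) (simp_all add: iff)
  qed
qed

end
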